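(* Let $n\geq 1$ be an integer and let $X$ be a strongly locally homogeneous $LC^{n-1}$-space. If $X$ is nowhere locally compact, then $X$ is an almost homology $n$-manifold.
   Context: All spaces are assumed to be non-empty, locally connected, separable and completely metrizable, and all maps are continuous. $\mathbb{B}^{k}$ denotes the $k$-dimensional closed ball. A space $X$ is strongly locally homogeneous if every point $x\in X$ has a base of neighborhoods $U$ such that for every $y,z\in U$ there exists a homeomorphism $h$ of $X$ onto itself with $h(y)=z$ and $h$ equal to the identity on $X\setminus U$. A space $X$ is $LC^k$ if for every $x\in X$ and every neighborhood $U$ of $x$ there exists a neighborhood $V\subset U$ of $x$ such that the inclusion $V\hookrightarrow U$ induces trivial homomorphisms $\pi_m(V)\to\pi_m(U)$ for all $m\leq k$ (equivalently, every map $\mathbb{S}^m\to V$ extends to a map $\mathbb{B}^{m+1}\to U$ for all $0\le m\leq k$). A space is nowhere locally compact if no point has a compact neighborhood. A non-trivial (i.e. having more than one point) separable metric space $X$ is an almost homology $n$-manifold if $H_k(X,X\setminus\{x\};\mathbb{Z})=0$ (singular homology) for all $x\in X$ and all $k=0,1,\dots,n-1$. *)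

theory Defs
  imports "HOL-Analysis.Analysis" "HOL-Homology.Homology"
begin

(* The standing assumption on all spaces. *)
definition standard_space :: "'a topology \<Rightarrow> bool" where
  "standard_space X \<longleftrightarrow>
     topspace X \<noteq> {} \<and> locally_connected_space X \<and> separable_space X \<and>
     completely_metrizable_space X"

(* Neighbourhoods need not be open: neighbourhood_base_at ranges over sets U that contain an
   open set around x. *)
definition strongly_locally_homogeneous :: "'a topology \<Rightarrow> bool" where
  "strongly_locally_homogeneous X \<longleftrightarrow>
     (\<forall>x \<in> topspace X. neighbourhood_base_at x
        (\<lambda>U. \<forall>y \<in> U. \<forall>z \<in> U. \<exists>h. homeomorphic_map X X h \<and> h y = z \<and>
               (\<forall>w \<in> topspace X - U. h w = w)) X)"

(* The closed unit ball of Euclidean k-space; nsphere m is the boundary of nball (Suc m). *)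
definition nball :: "nat \<Rightarrow> (nat \<Rightarrow> real) topology" where
  "nball k = subtopology (Euclidean_space k) {x. (\<Sum>i<k. x i ^ 2) \<le> 1}"

(* Every map of the m-sphere into V extends to a map of the (m+1)-ball into U. This says that
   the inclusion of V in U is trivial on the m-th homotopy groups for all base points in V
   (for m = 0, on sets of path components). *)
definition sphere_maps_extend :: "nat \<Rightarrow> 'a topology \<Rightarrow> 'a set \<Rightarrow> 'a set \<Rightarrow> bool" where
  "sphere_maps_extend m X V U \<longleftrightarrow>
     (\<forall>f. continuous_map (nsphere m) (subtopology X V) f \<longrightarrow>
       (\<exists>g. continuous_map (nball (Suc m)) (subtopology X U) g \<and>
            (\<forall>s \<in> topspace (nsphere m). g s = f s)))"

definition LC_space :: "nat \<Rightarrow> 'a topology \<Rightarrow> bool" where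
  "LC_space k X \<longleftrightarrow>
     (\<forall>x \<in> topspace X. \<forall>U. openin X U \<and> x \<in> U \<longrightarrow>
       (\<exists>V. openin X V \<and> x \<in> V \<and> V \<subseteq> U \<and> (\<forall>m \<le> k. sphere_maps_extend m X V U)))"

definition nowhere_locally_compact :: "'a topology \<Rightarrow> bool" where
  "nowhere_locally_compact X \<longleftrightarrow>
     (\<forall>x \<in> topspace X. \<not> (\<exists>U K. openin X U \<and> compactin X K \<and> x \<in> U \<and> U \<subseteq> K))"

(* relative_homology_group is singular homology with integer coefficients. *)
definition almost_homology_manifold :: "nat \<Rightarrow> 'a topology \<Rightarrow> bool" where
  "almost_homology_manifold n X \<longleftrightarrow>
     (\<exists>x \<in> topspace X. \<exists>y \<in> topspace X. x \<noteq> y) \<and> separable_space X \<and> metrizable_space X \<and>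
     (\<forall>x \<in> topspace X. \<forall>k < n.
        trivial_group (relative_homology_group (int k) X (topspace X - {x})))"

end

theory Submission
  imports Defs
begin

text \<open>
  The \<open>LC\<close> hypothesis makes small cycles bound: around every point \<open>x\<close> there is a neighbourhood \<open>V\<close> on
  whose singular simplices of dimension less than \<open>n\<close> a cone with apex \<open>x\<close> can be built, dimension by
  dimension, each time extending a map from the boundary of a simplex into its interior.  Given a
  relative \<open>k\<close>-cycle of \<open>(X, X - {x})\<close> with \<open>k < n\<close>, excision replaces it by a chain \<open>d\<close> in \<open>V\<close> with boundary in
  \<open>V - {x}\<close>.  The support of \<open>d\<close> is compact, so it contains no neighbourhood of \<open>x\<close>; strong local
  homogeneity gives a homeomorphism \<open>h\<close>, supported in \<open>V\<close> away from the boundary of \<open>d\<close>, which moves to \<open>x\<close>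
  a point outside the support.  Then \<open>h d\<close> avoids \<open>x\<close>, and \<open>d - h d\<close> is a cycle in \<open>V\<close>, hence bounds.
\<close>

section \<open>Comparing the standard simplex and its boundary with the ball and its sphere\<close>

lemma continuous_on_Max_image:
  fixes f :: "'i \<Rightarrow> 'b::topological_space \<Rightarrow> real"
  assumes "finite I" "I \<noteq> {}" "\<And>i. i \<in> I \<Longrightarrow> continuous_on S (f i)"
  shows "continuous_on S (\<lambda>x. Max ((\<lambda>i. f i x) ` I))"
  using assms
proof (induction rule: finite_ne_induct)
  case (singleton i)
  then show ?case by simp
next
  case (insert i F)
  then have "continuous_on S (\<lambda>x. max (f i x) (Max ((\<lambda>i. f i x) ` F)))"
    by (intro continuous_intros) auto
  moreover have "Max ((\<lambda>i. f i x) ` insert i F) = max (f i x) (Max ((\<lambda>i. f i x) ` F))" for x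
    using insert by simp
  ultimately show ?case by presburger
qed

definition simplex_boundary :: "nat \<Rightarrow> (nat \<Rightarrow> real) set"
  where "simplex_boundary q = {x \<in> standard_simplex q. \<exists>i\<le>q. x i = 0}"

lemma nsphere_top_of_set:
  "nsphere p = top_of_set {x. (\<Sum>i\<le>p. x i ^ 2) = 1 \<and> (\<forall>i>p. x i = 0)}"
  by (simp add: nsphere euclidean_product_topology)

lemma nball_top_of_set:
  "nball q = top_of_set {x. (\<Sum>i<q. x i ^ 2) \<le> 1 \<and> (\<forall>i\<ge>q. x i = 0)}"
  by (simp add: nball_def Euclidean_space_def euclidean_product_topology
      subtopology_subtopology Collect_conj_eq Int_commute)

lemma continuous_on_component [continuous_intros]:
  "continuous_on S (\<lambda>x :: nat \<Rightarrow> real. x i)"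
  by (rule continuous_on_subset[OF continuous_on_product_coordinates]) simp

text \<open>
  Radial projection from the barycentre.  Adding the product of the coordinates, which vanishes exactly
  on the boundary, to the norm keeps the denominator positive at the barycentre.
\<close>

lemma simplex_to_ball:
  fixes q :: nat
  defines "c \<equiv> 1 / real (Suc q)"
  defines "N \<equiv> \<lambda>x :: nat \<Rightarrow> real. sqrt (\<Sum>i<q. (x i - c)\<^sup>2)"
  defines "\<phi> \<equiv> \<lambda>x i. if i < q then (x i - c) / (N x + (\<Prod>i\<le>q. x i)) else 0"
  shows "continuous_map (top_of_set (standard_simplex q)) (nball q) \<phi>"
    and "x \<in> simplex_boundary q \<Longrightarrow> N x > 0"
    and "x \<in> simplex_boundary q \<Longrightarrow> \<phi> x = (\<lambda>i. if i < q then (x i - c) / N x else 0)"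
    and "x \<in> simplex_boundary q \<Longrightarrow> (\<Sum>i<q. (\<phi> x i)\<^sup>2) = 1"
proof -
  have cpos: "c > 0" by (simp add: c_def)
  have N0: "N x \<ge> 0" for x by (simp add: N_def sum_nonneg)
  have P0: "(\<Prod>i\<le>q. x i) \<ge> 0" if "x \<in> standard_simplex q" for x :: "nat \<Rightarrow> real"
    using that by (auto simp: standard_simplex_def intro: prod_nonneg)
  have all_c: "x i = c" if x: "x \<in> standard_simplex q" and "N x = 0" and i: "i \<le> q" for x i
  proof -
    have eq: "x i = c" if "i < q" for i
      using \<open>N x = 0\<close> that by (simp add: N_def sum_nonneg_eq_0_iff)
    have "1 = (\<Sum>i\<le>q. x i)" using x by (simp add: standard_simplex_def)
    also have "\<dots> = (\<Sum>i<q. x i) + x q"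
      by (simp flip: lessThan_Suc_atMost)
    also have "(\<Sum>i<q. x i) = q * c" using eq by simp
    finally have "x q = c" by (simp add: c_def field_simps)
    with eq i show ?thesis by (cases "i = q") auto
  qed
  have pos: "N x + (\<Prod>i\<le>q. x i) > 0" if x: "x \<in> standard_simplex q" for x
  proof (cases "N x = 0")
    case True
    with all_c[OF x True] cpos have "(\<Prod>i\<le>q. x i) > 0" by (intro prod_pos) auto
    with True show ?thesis by simp
  next
    case False
    with N0[of x] P0[OF x] show ?thesis by linarith
  qed
  \<comment> \<open>The quotient is at most 1 because the product is nonnegative on the simplex, and
    equals 1 where the product vanishes.\<close>
  have sq: "(\<Sum>i<q. (\<phi> x i)\<^sup>2) = (N x)\<^sup>2 / (N x + (\<Prod>i\<le>q. x i))\<^sup>2" for x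
    by (simp add: \<phi>_def power_divide N_def sum_nonneg flip: sum_divide_distrib)
  have le1: "(\<Sum>i<q. (\<phi> x i)\<^sup>2) \<le> 1" if x: "x \<in> standard_simplex q" for x
  proof -
    have "(N x)\<^sup>2 \<le> (N x + (\<Prod>i\<le>q. x i))\<^sup>2"
      using N0 P0[OF x] by (intro power_mono) auto
    then show ?thesis unfolding sq using pos[OF x] by (simp add: divide_le_eq_1)
  qed
  have contN: "continuous_on (standard_simplex q) N"
    unfolding N_def by (intro continuous_intros)
  have "continuous_on (standard_simplex q) (\<lambda>x. \<phi> x i)" for i
    unfolding \<phi>_def using pos
    by (cases "i < q") (auto intro!: continuous_intros contN simp: less_imp_neq[THEN not_sym])
  then have "continuous_on (standard_simplex q) \<phi>"
    by (rule continuous_on_coordinatewise_then_product)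
  moreover have "\<phi> x i = 0" if "i \<ge> q" for x i using that by (simp add: \<phi>_def)
  ultimately show "continuous_map (top_of_set (standard_simplex q)) (nball q) \<phi>"
    using le1 by (auto simp: nball_top_of_set)
  assume x: "x \<in> simplex_boundary q"
  then have "prod x {..q} = 0" by (auto simp: simplex_boundary_def)
  with x pos[of x] show "N x > 0" by (simp add: simplex_boundary_def)
  with \<open>prod x {..q} = 0\<close> show "(\<Sum>i<q. (\<phi> x i)\<^sup>2) = 1"
    unfolding sq \<open>prod x {..q} = 0\<close> by simp
  show "\<phi> x = (\<lambda>i. if i < q then (x i - c) / N x else 0)"
    unfolding \<phi>_def \<open>prod x {..q} = 0\<close> by (simp cong: if_cong)
qed

text \<open>This undoes the radial projection. \<open>w y\<close> completes \<open>y\<close> to a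
  direction with coordinate sum zero, and the ray from the barycentre in this direction leaves the
  simplex when its first coordinate reaches 0, which happens at time \<open>c / M y\<close>.\<close>

lemma sphere_to_simplex_boundary:
  fixes p :: nat
  defines "q \<equiv> Suc p"
  defines "c \<equiv> 1 / real (Suc q)"
  defines "w \<equiv> \<lambda>(y :: nat \<Rightarrow> real) i. if i < q then y i else - (\<Sum>l<q. y l)"
  defines "M \<equiv> \<lambda>y. Max ((\<lambda>i. - w y i) ` {..q})"
  defines "\<psi> \<equiv> \<lambda>y i. if i \<le> q then c * (1 + w y i / M y) else 0"
  shows "continuous_map (nsphere p) (top_of_set (simplex_boundary q)) \<psi>"
proof -
  define S where "S = {y :: nat \<Rightarrow> real. (\<Sum>i\<le>p. y i ^ 2) = 1 \<and> (\<forall>i>p. y i = 0)}"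
  have cpos: "c > 0" by (simp add: c_def)
  have sum0: "(\<Sum>i\<le>q. w y i) = 0" for y
    by (simp add: w_def flip: lessThan_Suc_atMost)
  have wM: "- w y i \<le> M y" if "i \<le> q" for y i
    unfolding M_def using that by (intro Max_ge) auto
  \<comment> \<open>If no coordinate of \<open>w y\<close> were negative, the zero sum would force
    \<open>w y = 0\<close>, hence \<open>y = 0\<close>, which is not on the sphere.\<close>
  have Mpos: "M y > 0" if "y \<in> S" for y
  proof (rule ccontr)
    assume "\<not> M y > 0"
    then have nn: "w y i \<ge> 0" if "i \<le> q" for i using wM[OF that, of y] by linarith
    then have "w y i = 0" if "i \<le> q" for i
      using sum0[of y] that by (subst (asm) sum_nonneg_eq_0_iff) auto
    then have "y i = 0" if "i \<le> p" for i
      using that unfolding w_def q_def by (metis le_imp_less_Suc less_imp_le)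
    with \<open>y \<in> S\<close> show False by (simp add: S_def)
  qed
  have contw: "continuous_on S (\<lambda>y. w y i)" for i
    unfolding w_def by (cases "i < q") (auto intro!: continuous_intros)
  have contM: "continuous_on S M"
    unfolding M_def by (intro continuous_on_Max_image continuous_intros contw) auto
  have "continuous_on S (\<lambda>y. \<psi> y i)" for i
    unfolding \<psi>_def using Mpos
    by (cases "i \<le> q") (auto intro!: continuous_intros contw contM simp: less_imp_neq[THEN not_sym])
  then have "continuous_on S \<psi>"
    by (rule continuous_on_coordinatewise_then_product)
  moreover have "\<psi> y \<in> simplex_boundary q" if "y \<in> S" for y
  proof -
    have nn: "\<psi> y i \<ge> 0" for i
    proof (cases "i \<le> q")
      case True
      with wM[OF True, of y] Mpos[OF that] have "1 + w y i / M y \<ge> 0" by (simp add: field_simps)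
      with cpos show ?thesis by (simp add: \<psi>_def)
    qed (simp add: \<psi>_def)
    have sum1: "(\<Sum>i\<le>q. \<psi> y i) = 1"
    proof -
      have "(\<Sum>i\<le>q. \<psi> y i) = c * (Suc q + (\<Sum>i\<le>q. w y i) / M y)"
        by (simp add: \<psi>_def sum.distrib flip: sum_distrib_left sum_divide_distrib)
      then show ?thesis by (simp only: sum0) (simp add: c_def)
    qed
    have "\<psi> y i \<le> 1" for i
    proof (cases "i \<le> q")
      case True
      then have "\<psi> y i \<le> (\<Sum>i\<le>q. \<psi> y i)"
        using nn by (intro member_le_sum) auto
      with sum1 show ?thesis by simp
    qed (simp add: \<psi>_def)
    \<comment> \<open>The maximum is attained, and an index attaining it gives a vanishing
      coordinate, so the point lies on a face.\<close>
    moreover have "M y \<in> (\<lambda>i. - w y i) ` {..q}"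
      unfolding M_def by (intro Max_in) auto
    then obtain i where "i \<le> q" "M y = - w y i" by auto
    then have "\<psi> y i = 0" using Mpos[OF that] by (simp add: \<psi>_def)
    moreover have "\<psi> y i = 0" if "i > q" for i using that by (simp add: \<psi>_def)
    ultimately show ?thesis
      using nn sum1 \<open>i \<le> q\<close> by (auto simp: simplex_boundary_def standard_simplex_def)
  qed
  ultimately show ?thesis
    by (auto simp: nsphere_top_of_set S_def)
qed

text \<open>A one-sided inverse suffices for extension problems: a map \<open>f\<close> on the
  boundary of the simplex becomes \<open>f \<circ> \<psi>\<close> on the sphere, and an extension of
  that to the ball, composed with \<open>\<phi>\<close>, restricts to \<open>f\<close>
  again.\<close>

lemma simplex_ball_maps:
  obtains \<phi> \<psi> where
    "continuous_map (top_of_set (standard_simplex (Suc p))) (nball (Suc p)) \<phi>"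
    "continuous_map (nsphere p) (top_of_set (simplex_boundary (Suc p))) \<psi>"
    "\<And>x. x \<in> simplex_boundary (Suc p) \<Longrightarrow> \<phi> x \<in> topspace (nsphere p)"
    "\<And>x. x \<in> simplex_boundary (Suc p) \<Longrightarrow> \<psi> (\<phi> x) = x"
proof -
  define q where "q = Suc p"
  define c where "c = 1 / real (Suc q)"
  define N where "N = (\<lambda>x :: nat \<Rightarrow> real. sqrt (\<Sum>i<q. (x i - c)\<^sup>2))"
  define \<phi> where "\<phi> = (\<lambda>x i. if i < q then (x i - c) / (N x + (\<Prod>i\<le>q. x i)) else 0)"
  define w where "w = (\<lambda>(y :: nat \<Rightarrow> real) i. if i < q then y i else - (\<Sum>l<q. y l))"
  define M where "M = (\<lambda>y. Max ((\<lambda>i. - w y i) ` {..q}))"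
  define \<psi> where "\<psi> = (\<lambda>y i. if i \<le> q then c * (1 + w y i / M y) else 0)"
  have \<phi>: "continuous_map (top_of_set (standard_simplex q)) (nball q) \<phi>"
    and Npos: "\<And>x. x \<in> simplex_boundary q \<Longrightarrow> N x > 0"
    and \<phi>_eq: "\<And>x. x \<in> simplex_boundary q \<Longrightarrow> \<phi> x = (\<lambda>i. if i < q then (x i - c) / N x else 0)"
    and \<phi>_1: "\<And>x. x \<in> simplex_boundary q \<Longrightarrow> (\<Sum>i<q. (\<phi> x i)\<^sup>2) = 1"
    unfolding \<phi>_def N_def c_def by (fact simplex_to_ball)+
  have \<psi>: "continuous_map (nsphere p) (top_of_set (simplex_boundary q)) \<psi>"
    unfolding \<psi>_def M_def w_def c_def q_def by (rule sphere_to_simplex_boundary)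
  have "\<psi> (\<phi> x) = x" if x: "x \<in> simplex_boundary q" for x
  proof -
    have sumx: "(\<Sum>i<q. x i) + x q = 1" and nn: "\<And>i. x i \<ge> 0" and zero: "\<And>i. i > q \<Longrightarrow> x i = 0"
      using x by (auto simp: simplex_boundary_def standard_simplex_def simp flip: lessThan_Suc_atMost)
    \<comment> \<open>\<open>\<phi>\<close> discards the last coordinate, but \<open>w\<close>
      recovers it, since the deviations from the barycentre sum to zero.\<close>
    have w: "w (\<phi> x) i = (x i - c) / N x" if "i \<le> q" for i
    proof (cases "i < q")
      case False
      then have "w (\<phi> x) i = - (\<Sum>l<q. (x l - c) / N x)"
        by (simp add: w_def \<phi>_eq[OF x])
      also have "(\<Sum>l<q. (x l - c) / N x) = ((\<Sum>l<q. x l) - q * c) / N x"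
        by (simp add: sum_subtractf flip: sum_divide_distrib)
      also have "(\<Sum>l<q. x l) - q * c = - (x q - c)"
      proof -
        have "q * c = 1 - c" by (simp add: c_def field_simps)
        with sumx show ?thesis by linarith
      qed
      also have "- (- (x q - c) / N x) = (x q - c) / N x"
        by (simp only: minus_divide_left minus_minus)
      finally show ?thesis using False that by simp
    qed (simp add: w_def \<phi>_eq[OF x])
    obtain j where j: "j \<le> q" "x j = 0" using x by (auto simp: simplex_boundary_def)
    \<comment> \<open>The smallest coordinate of a boundary point is 0, so the largest value of
      \<open>c - x i\<close> is \<open>c\<close>.\<close>
    have "M (\<phi> x) = c / N x"
      unfolding M_def
    proof (rule Max_eqI)
      show "y \<le> c / N x" if "y \<in> (\<lambda>i. - w (\<phi> x) i) ` {..q}" for y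
        using that nn Npos[OF x] by (auto simp: w field_simps)
      show "c / N x \<in> (\<lambda>i. - w (\<phi> x) i) ` {..q}"
        using j by (intro image_eqI[of _ _ j]) (auto simp: w)
    qed simp
    moreover have "c > 0" by (simp add: c_def)
    ultimately have "c * (1 + w (\<phi> x) i / M (\<phi> x)) = x i" if "i \<le> q" for i
      using Npos[OF x] that by (simp add: w field_simps)
    then show ?thesis
      using zero by (auto simp: fun_eq_iff \<psi>_def)
  qed
  moreover have "\<phi> x \<in> topspace (nsphere p)" if "x \<in> simplex_boundary q" for x
    using \<phi>_1[OF that] by (auto simp: nsphere q_def lessThan_Suc_atMost \<phi>_def)
  ultimately show thesis using that \<phi> \<psi> by (simp add: q_def)
qed

section \<open>Face identities and filling the boundary of a simplex\<close>

text \<open>Inverse of the face inclusion \<open>simplical_face i\<close> on the face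
  \<open>x i = 0\<close>; it turns a singular simplex into a function on that face.\<close>

definition drop_coord :: "nat \<Rightarrow> (nat \<Rightarrow> 'a) \<Rightarrow> nat \<Rightarrow> 'a"
  where "drop_coord i x = (\<lambda>l. if l < i then x l else x (Suc l))"

lemma drop_coord_simplical_face: "drop_coord i (simplical_face i x) = x"
  by (auto simp: drop_coord_def simplical_face_def fun_eq_iff)

lemma simplical_face_drop_coord: "x i = 0 \<Longrightarrow> simplical_face i (drop_coord i x) = x"
  by (auto simp: drop_coord_def simplical_face_def fun_eq_iff)

lemma drop_coord_drop_coord:
  "i < j \<Longrightarrow> drop_coord i (drop_coord j x) = drop_coord (j - 1) (drop_coord i x)"
  by (auto simp: drop_coord_def fun_eq_iff)

lemma drop_coord_in_standard_simplex:
  assumes x: "x \<in> standard_simplex (Suc p)" and "x i = 0" "i \<le> Suc p"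
  shows "drop_coord i x \<in> standard_simplex p"
proof -
  have "(\<Sum>l\<le>p. drop_coord i x l) = (\<Sum>l\<in>{..Suc p} - {i}. x l)"
    using \<open>i \<le> Suc p\<close>
    by (intro sum.reindex_bij_witness[of _ "\<lambda>l. if l < i then l else l - 1"
          "\<lambda>l. if l < i then l else Suc l"])
       (auto simp: drop_coord_def)
  also have "\<dots> = (\<Sum>l\<le>Suc p. x l)"
    using \<open>x i = 0\<close> by (intro sum.mono_neutral_left) auto
  finally show ?thesis
    using x \<open>i \<le> Suc p\<close> by (auto simp: standard_simplex_def drop_coord_def simp del: sum.atMost_Suc)
qed

lemma simplical_face_in_simplex_boundary:
  "x \<in> standard_simplex p \<Longrightarrow> i \<le> Suc p \<Longrightarrow> simplical_face i x \<in> simplex_boundary (Suc p)"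
  using simplical_face_in_standard_simplex[of "Suc p" i x]
  by (auto simp: simplex_boundary_def simplical_face_def intro!: exI[of _ i])

lemma simplical_face_simplical_face:
  "i < j \<Longrightarrow> simplical_face j (simplical_face i x) = simplical_face i (simplical_face (j - 1) x)"
  by (auto simp: simplical_face_def fun_eq_iff)

lemma singular_face_singular_face:
  assumes "i < j" "j \<le> Suc p" "p \<ge> 1"
  shows "singular_face p i (singular_face (Suc p) j f) = singular_face p (j - 1) (singular_face (Suc p) i f)"
proof (rule ext)
  fix x
  show "singular_face p i (singular_face (Suc p) j f) x = singular_face p (j - 1) (singular_face (Suc p) i f) x"
    using assms simplical_face_in_standard_simplex[of p i x]
      simplical_face_in_standard_simplex[of p "j - 1" x]
      simplical_face_simplical_face[of i j x]
    by (auto simp: singular_face_def)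
qed

lemma singular_simplex_euclidean:
  "singular_simplex p X f \<longleftrightarrow>
     continuous_map (top_of_set (standard_simplex p)) X f \<and> f \<in> extensional (standard_simplex p)"
  by (simp add: singular_simplex_def euclidean_product_topology)

text \<open>The face identities say that the \<open>F i\<close> agree on intersections of faces, so
  they paste along finitely many closed sets to a map on the boundary. Transported to the sphere, it
  extends over the ball by \<open>ext\<close>; \<open>\<phi>\<close> pulls the extension back to the
  simplex.\<close>

lemma simplex_filler:
  assumes ext: "sphere_maps_extend p X V U"
    and F: "\<And>i. i \<le> Suc p \<Longrightarrow> singular_simplex p (subtopology X V) (F i)"
    and compat: "\<And>i j. \<lbrakk>p \<ge> 1; i < j; j \<le> Suc p\<rbrakk> \<Longrightarrow>
                   singular_face p i (F j) = singular_face p (j - 1) (F i)"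
  obtains G where "singular_simplex (Suc p) (subtopology X U) G"
    "\<And>i. i \<le> Suc p \<Longrightarrow> singular_face (Suc p) i G = F i"
proof -
  let ?B = "simplex_boundary (Suc p)"
  define T where "T i = {x \<in> ?B. x i = 0}" for i
  have drop_in: "drop_coord i x \<in> standard_simplex p" if "x \<in> T i" "i \<le> Suc p" for x i
    using that by (intro drop_coord_in_standard_simplex) (auto simp: T_def simplex_boundary_def)
  have agree: "F i (drop_coord i x) = F j (drop_coord j x)"
    if x: "x \<in> T i" "x \<in> T j" and ij: "i < j" "j \<le> Suc p" for i j x
  proof -
    \<comment> \<open>For \<open>p = 0\<close> the two faces are the distinct endpoints of an edge,
      so they do not meet.\<close>
    have "p \<ge> 1"
    proof (rule ccontr)
      assume "\<not> p \<ge> 1"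
      with ij have "p = 0" "i = 0" "j = 1" by auto
      with x show False by (auto simp: T_def simplex_boundary_def standard_simplex_def)
    qed
    then have p: "Suc (p - 1) = p" by simp
    \<comment> \<open>\<open>?z\<close> represents \<open>x\<close> in the face of codimension two
      on which both coordinates vanish; both sides are evaluated there.\<close>
    let ?z = "drop_coord i (drop_coord j x)"
    have z0: "drop_coord j x i = 0" "drop_coord i x (j - 1) = 0"
      using x ij by (auto simp: drop_coord_def T_def)
    have z: "?z \<in> standard_simplex (p - 1)"
      using drop_coord_in_standard_simplex[of "drop_coord j x" "p - 1" i] drop_in[OF x(2)] z0 ij p
      by simp
    have "F j (drop_coord j x) = F j (simplical_face i ?z)"
      using z0 by (simp add: simplical_face_drop_coord)
    also have "\<dots> = singular_face p i (F j) ?z"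
      using z by (simp add: singular_face_def)
    also have "\<dots> = singular_face p (j - 1) (F i) ?z"
      using compat \<open>p \<ge> 1\<close> ij by simp
    also have "\<dots> = F i (simplical_face (j - 1) ?z)"
      using z by (simp add: singular_face_def)
    also have "\<dots> = F i (drop_coord i x)"
      using z0 ij by (simp add: drop_coord_drop_coord simplical_face_drop_coord)
    finally show ?thesis by simp
  qed
  obtain f where f: "continuous_map (top_of_set ?B) (subtopology X V) f"
    and feq: "\<And>x i. \<lbrakk>i \<in> {..Suc p}; x \<in> topspace (top_of_set ?B) \<inter> T i\<rbrakk> \<Longrightarrow> f x = (F i \<circ> drop_coord i) x"
  proof (rule pasting_lemma_exists_closed)
    show "finite {..Suc p}" by simp
    show "topspace (top_of_set ?B) \<subseteq> \<Union> (T ` {..Suc p})"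
      by (auto simp: T_def simplex_boundary_def)
    show "closedin (top_of_set ?B) (T i)" for i
      unfolding T_def by (intro continuous_closedin_preimage_constant continuous_intros)
    show "continuous_map (subtopology (top_of_set ?B) (T i)) (subtopology X V) (F i \<circ> drop_coord i)"
      if "i \<in> {..Suc p}" for i
    proof (rule continuous_map_compose)
      have "continuous_on S (\<lambda>x :: nat \<Rightarrow> real. drop_coord i x l)" for S l
        by (cases "l < i") (auto simp: drop_coord_def intro!: continuous_intros)
      then have "continuous_on S (drop_coord i :: (nat \<Rightarrow> real) \<Rightarrow> _)" for S
        by (rule continuous_on_coordinatewise_then_product)
      then show "continuous_map (subtopology (top_of_set ?B) (T i)) (top_of_set (standard_simplex p)) (drop_coord i)"
        using drop_in that by (auto simp: subtopology_subtopology)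
      show "continuous_map (top_of_set (standard_simplex p)) (subtopology X V) (F i)"
        using F that by (simp add: singular_simplex_euclidean)
    qed
    show "(F i \<circ> drop_coord i) x = (F j \<circ> drop_coord j) x"
      if "i \<in> {..Suc p}" "j \<in> {..Suc p}" "x \<in> topspace (top_of_set ?B) \<inter> T i \<inter> T j" for i j x
    proof -
      have "x \<in> T i" "x \<in> T j" "i \<le> Suc p" "j \<le> Suc p" using that by simp_all
      then have "F i (drop_coord i x) = F j (drop_coord j x)"
        by (metis agree linorder_neqE_nat)
      then show ?thesis by simp
    qed
  qed blast
  obtain \<phi> \<psi> where
    \<phi>: "continuous_map (top_of_set (standard_simplex (Suc p))) (nball (Suc p)) \<phi>" and
    \<psi>: "continuous_map (nsphere p) (top_of_set ?B) \<psi>" and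
    \<phi>B: "\<And>x. x \<in> ?B \<Longrightarrow> \<phi> x \<in> topspace (nsphere p)" and
    \<psi>\<phi>: "\<And>x. x \<in> ?B \<Longrightarrow> \<psi> (\<phi> x) = x"
    using simplex_ball_maps by blast
  obtain g where g: "continuous_map (nball (Suc p)) (subtopology X U) g"
    and gf: "\<And>s. s \<in> topspace (nsphere p) \<Longrightarrow> g s = (f \<circ> \<psi>) s"
    using ext continuous_map_compose[OF \<psi> f] unfolding sphere_maps_extend_def by blast
  define G where "G = restrict (g \<circ> \<phi>) (standard_simplex (Suc p))"
  show thesis
  proof
    have "continuous_map (top_of_set (standard_simplex (Suc p))) (subtopology X U) G"
      using continuous_map_compose[OF \<phi> g] by (rule continuous_map_eq) (simp add: G_def)
    then show "singular_simplex (Suc p) (subtopology X U) G"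
      by (simp add: singular_simplex_euclidean G_def)
    show "singular_face (Suc p) i G = F i" if i: "i \<le> Suc p" for i
    proof (rule extensionalityI[of _ "standard_simplex p"])
      show "F i \<in> extensional (standard_simplex p)"
        using F[OF i] by (simp add: singular_simplex_def)
      fix x assume x: "x \<in> standard_simplex p"
      then have y: "simplical_face i x \<in> ?B" using i by (rule simplical_face_in_simplex_boundary)
      then have "simplical_face i x \<in> T i" by (simp add: T_def simplical_face_def)
      then show "singular_face (Suc p) i G x = F i x"
        using x y i \<phi>B[OF y] \<psi>\<phi>[OF y] feq[of i "simplical_face i x"]
        by (simp add: singular_face_def G_def gf drop_coord_simplical_face simplex_boundary_def)
    qed (simp add: singular_face_def)
  qed
qed

section \<open>Cones over small singular simplices\<close>

text \<open>
  Degrees are shifted by one: \<open>Q (Suc j)\<close> cones off \<open>j\<close>-simplices, and \<open>Q 0\<close> plays the part of the cone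
  over the empty simplex, namely the apex.
\<close>

definition cone_operator where
  "cone_operator m X V U x Q \<longleftrightarrow> Q 0 = simplex_map 0 (\<lambda>_. x) \<and>
     (\<forall>j<m. \<forall>\<sigma>. singular_simplex j (subtopology X V) \<sigma> \<longrightarrow>
        singular_simplex (Suc j) (subtopology X U) (Q (Suc j) \<sigma>) \<and>
        singular_face (Suc j) 0 (Q (Suc j) \<sigma>) = \<sigma> \<and>
        (\<forall>i\<le>j. singular_face (Suc j) (Suc i) (Q (Suc j) \<sigma>) = Q j (singular_face j i \<sigma>)))"

lemma simplex_map_const: "simplex_map 0 (\<lambda>_. x) \<sigma> = simplex_map 0 (\<lambda>_. x) \<tau>"
  by (auto simp: simplex_map_def)

text \<open>Each dimension costs one shrinking: \<open>m\<close>-spheres in \<open>W\<close> extend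
  into \<open>U\<close>, and the induction hypothesis, applied to \<open>W\<close>, cones off lower
  simplices of \<open>V\<close> inside \<open>W\<close>. A simplex in \<open>V\<close> and the cones
  over its faces then form the boundary of an \<open>(m+1)\<close>-simplex in \<open>W\<close>,
  which can be filled in \<open>U\<close>.\<close>

lemma LC_space_imp_cone_operator:
  assumes LC: "LC_space k X" and x: "x \<in> topspace X" and "m \<le> Suc k"
    and "openin X U" "x \<in> U"
  shows "\<exists>V Q. openin X V \<and> x \<in> V \<and> V \<subseteq> U \<and> cone_operator m X V U x Q"
  using assms(3-)
proof (induction m arbitrary: U)
  case 0
  have "cone_operator 0 X U U x (\<lambda>_. simplex_map 0 (\<lambda>_. x))"
    by (simp add: cone_operator_def)
  with 0 show ?case by blast
next
  case (Suc m)
  then obtain W where W: "openin X W" "x \<in> W" "W \<subseteq> U" and ext: "sphere_maps_extend m X W U"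
    using LC x unfolding LC_space_def by (metis Suc_le_mono)
  obtain V Q where V: "openin X V" "x \<in> V" "V \<subseteq> W" and Q: "cone_operator m X V W x Q"
    using Suc.IH[OF _ W(1,2)] Suc.prems(1) by auto
  have Q0: "Q 0 = simplex_map 0 (\<lambda>_. x)"
    using Q by (simp add: cone_operator_def)
  have Qs: "singular_simplex j (subtopology X W) (Q j (singular_face j i \<sigma>))"
    if "singular_simplex j (subtopology X V) \<sigma>" "j \<le> m" "i \<le> j" for i j \<sigma>
  proof (cases j)
    \<comment> \<open>A face of a 0-simplex has no meaning, but \<open>Q 0\<close> ignores its
      argument and returns the apex.\<close>
    case 0
    have "continuous_map (top_of_set (standard_simplex 0)) (subtopology X W) (\<lambda>_. x)"
      using W x by simp
    then have "singular_simplex 0 (subtopology X W) (Q 0 \<tau>)" for \<tau>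
      unfolding singular_simplex_euclidean Q0 simplex_map_def
      by (auto elim: continuous_map_eq)
    with 0 show ?thesis by simp
  next
    case (Suc l)
    then show ?thesis
      using Q singular_simplex_singular_face[of j "subtopology X V" \<sigma> i] that
      by (auto simp: cone_operator_def)
  qed
  have "\<exists>G. singular_simplex (Suc m) (subtopology X U) G \<and> singular_face (Suc m) 0 G = \<sigma> \<and>
          (\<forall>i\<le>m. singular_face (Suc m) (Suc i) G = Q m (singular_face m i \<sigma>))"
    if \<sigma>: "singular_simplex m (subtopology X V) \<sigma>" for \<sigma>
  proof -
    \<comment> \<open>The prescribed faces of the cone: the base opposite the apex, then the cones
      over the faces of the base.\<close>
    define F where "F i = (case i of 0 \<Rightarrow> \<sigma> | Suc i \<Rightarrow> Q m (singular_face m i \<sigma>))" for i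
    obtain G where "singular_simplex (Suc m) (subtopology X U) G"
      "\<And>i. i \<le> Suc m \<Longrightarrow> singular_face (Suc m) i G = F i"
    proof (rule simplex_filler[OF ext])
      show "singular_simplex m (subtopology X W) (F i)" if "i \<le> Suc m" for i
        using that Qs[OF \<sigma>] singular_simplex_mono[OF \<sigma> \<open>V \<subseteq> W\<close>]
        by (auto simp: F_def split: nat.split)
      show "singular_face m i (F j) = singular_face m (j - 1) (F i)"
        if "m \<ge> 1" and ij: "i < j" "j \<le> Suc m" for i j
      proof -
        obtain l where m: "m = Suc l" using \<open>m \<ge> 1\<close> by (cases m) auto
        obtain j' where j: "j = Suc j'" "j' \<le> m" using ij by (cases j) auto
        have faces: "singular_simplex l (subtopology X V) (singular_face m a \<sigma>)" if "a \<le> m" for a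
          using singular_simplex_singular_face[OF \<sigma>, of a] that m by simp
        have Qf: "singular_face m 0 (Q m (singular_face m a \<sigma>)) = singular_face m a \<sigma>"
          "b \<le> l \<Longrightarrow> singular_face m (Suc b) (Q m (singular_face m a \<sigma>))
             = Q l (singular_face l b (singular_face m a \<sigma>))" if "a \<le> m" for a b
          using Q faces[OF that] unfolding m cone_operator_def by blast+
        show ?thesis
        proof (cases i)
          case 0
          then show ?thesis using j Qf by (simp add: F_def)
        next
          case (Suc i')
          with ij j have i': "i' < j'" "i' \<le> l" "j' - 1 \<le> l" "i' \<le> m" using m by auto
          have "Q l (singular_face l i' (singular_face m j' \<sigma>)) =
                Q l (singular_face l (j' - 1) (singular_face m i' \<sigma>))"
          proof (cases "l = 0")
            case True
            then show ?thesis by (metis Q0 simplex_map_const)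
          next
            case False
            then show ?thesis using singular_face_singular_face[of i' j' l \<sigma>] i' j m by simp
          qed
          then show ?thesis
            using Suc j i' Qf(2)[of j' i'] Qf(2)[of i' "j' - 1"] by (simp add: F_def)
        qed
      qed
    qed blast
    then show ?thesis by (intro exI[of _ G]) (auto simp: F_def)
  qed
  then obtain G where G: "\<And>\<sigma>. singular_simplex m (subtopology X V) \<sigma> \<Longrightarrow>
      singular_simplex (Suc m) (subtopology X U) (G \<sigma>) \<and> singular_face (Suc m) 0 (G \<sigma>) = \<sigma> \<and>
      (\<forall>i\<le>m. singular_face (Suc m) (Suc i) (G \<sigma>) = Q m (singular_face m i \<sigma>))"
    by metis
  have "cone_operator (Suc m) X V U x (Q(Suc m := G))"
    using Q G singular_simplex_mono[OF _ \<open>W \<subseteq> U\<close>]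
    by (auto simp: cone_operator_def less_Suc_eq)
  with V \<open>W \<subseteq> U\<close> show ?case by blast
qed

text \<open>The cone formula: face 0 gives back the base, and the other faces are the cones over its
  faces. As \<open>chain_boundary 0\<close> is zero, the apex term in degree 0 is written
  separately, as the image under a constant map.\<close>

lemma chain_boundary_cone_operator:
  assumes Q: "cone_operator m X V U x Q" and "p < m" and c: "singular_chain p (subtopology X V) c"
  shows "chain_boundary (Suc p) (frag_extend (frag_of \<circ> Q (Suc p)) c) =
     c - (if p = 0 then chain_map 0 (\<lambda>_. x) c else frag_extend (frag_of \<circ> Q p) (chain_boundary p c))"
  using c unfolding singular_chain_def
proof (induction c rule: frag_induction)
  case zero
  then show ?case by simp
next
  case (one \<sigma>)
  then have \<sigma>: "singular_face (Suc p) 0 (Q (Suc p) \<sigma>) = \<sigma>"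
      "\<And>i. i \<le> p \<Longrightarrow> singular_face (Suc p) (Suc i) (Q (Suc p) \<sigma>) = Q p (singular_face p i \<sigma>)"
    using Q \<open>p < m\<close> by (auto simp: cone_operator_def)
  have Q0: "Q 0 = simplex_map 0 (\<lambda>_. x)"
    using Q by (simp add: cone_operator_def)
  have "chain_boundary (Suc p) (frag_extend (frag_of \<circ> Q (Suc p)) (frag_of \<sigma>)) =
      frag_of \<sigma> - (\<Sum>i\<le>p. frag_cmul ((-1) ^ i) (frag_of (Q p (singular_face p i \<sigma>))))"
    by (simp add: chain_boundary_of sum.atMost_Suc_shift \<sigma> del: sum.atMost_Suc flip: sum_negf)
  \<comment> \<open>Shifting the face index by one has produced the minus sign. For
    \<open>p = 0\<close> the only summand is the constant simplex at \<open>x\<close>.\<close>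
  also have "(\<Sum>i\<le>p. frag_cmul ((-1) ^ i) (frag_of (Q p (singular_face p i \<sigma>)))) =
      (if p = 0 then chain_map 0 (\<lambda>_. x) (frag_of \<sigma>)
       else frag_extend (frag_of \<circ> Q p) (chain_boundary p (frag_of \<sigma>)))"
    by (auto simp: chain_boundary_of frag_extend_sum frag_extend_cmul Q0 simplex_map_const[of x "singular_face 0 0 \<sigma>" \<sigma>])
  finally show ?case .
next
  case (diff a b)
  then show ?case
    by (auto simp: frag_extend_diff chain_boundary_diff chain_map_diff)
qed

text \<open>In degree 0 the extra condition says that the coefficients sum to zero.\<close>

lemma LC_space_small_cycles_bound:
  assumes LC: "LC_space k X" and x: "x \<in> topspace X" and "p \<le> k"
    and U: "openin X U" "x \<in> U"
  obtains V where "openin X V" "x \<in> V" "V \<subseteq> U"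
    "\<And>c. \<lbrakk>singular_relcycle p (subtopology X V) {} c; p = 0 \<Longrightarrow> chain_map 0 (\<lambda>_. x) c = 0\<rbrakk>
       \<Longrightarrow> singular_relboundary p (subtopology X U) {} c"
proof -
  obtain V Q where V: "openin X V" "x \<in> V" "V \<subseteq> U" and Q: "cone_operator (Suc p) X V U x Q"
    using LC_space_imp_cone_operator[OF LC x _ U, of "Suc p"] \<open>p \<le> k\<close> by auto
  show thesis
  proof (rule that[OF V])
    fix c
    assume "singular_relcycle p (subtopology X V) {} c" and c0: "p = 0 \<Longrightarrow> chain_map 0 (\<lambda>_. x) c = 0"
    then have c: "singular_chain p (subtopology X V) c" "chain_boundary p c = 0"
      by (auto simp: singular_cycle)
    have "singular_chain (Suc p) (subtopology X U) (frag_extend (frag_of \<circ> Q (Suc p)) c)"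
      using c(1) Q by (intro singular_chain_extend) (auto simp: singular_chain_def cone_operator_def)
    \<comment> \<open>The correction term of the cone formula vanishes: by the cycle condition in
      positive degree, by \<open>c0\<close> in degree 0.\<close>
    moreover have "chain_boundary (Suc p) (frag_extend (frag_of \<circ> Q (Suc p)) c) = c"
      using chain_boundary_cone_operator[OF Q _ c(1)] c(2) c0 by simp
    ultimately show "singular_relboundary p (subtopology X U) {} c"
      unfolding singular_boundary by blast
  qed
qed

section \<open>Compact supports, and pushing a relative cycle off the point\<close>

lemma singular_chain_compact_support:
  assumes "singular_chain p X c"
  obtains K where "compactin X K" "singular_chain p (subtopology X K) c"
proof
  let ?K = "\<Union>\<sigma>\<in>Poly_Mapping.keys c. \<sigma> ` standard_simplex p"
  have \<sigma>: "singular_simplex p X \<sigma>" if "\<sigma> \<in> Poly_Mapping.keys c" for \<sigma>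
    using assms that by (auto simp: singular_chain_def)
  show "compactin X ?K"
  proof (rule compactin_Union, goal_cases)
    case (2 S)
    then obtain \<sigma> where "S = \<sigma> ` standard_simplex p" "singular_simplex p X \<sigma>"
      using \<sigma> by blast
    moreover have "compactin (top_of_set (standard_simplex p)) (standard_simplex p)"
      using compactin_standard_simplex[of p]
      by (simp add: compactin_subtopology euclidean_product_topology)
    ultimately show ?case
      unfolding singular_simplex_euclidean by (metis image_compactin)
  qed simp
  show "singular_chain p (subtopology X ?K) c"
    using assms by (auto simp: singular_chain_subtopology)
qed

theorem corollary1p3:
  fixes X :: "'a topology" and n :: nat
  assumes "n \<ge> 1"
    and "standard_space X"
    and "strongly_locally_homogeneous X"
    and "LC_space (n - 1) X"
    and "nowhere_locally_compact X"
  shows "almost_homology_manifold n X"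
proof -
  have metr: "metrizable_space X" and sep: "separable_space X" and ne: "topspace X \<noteq> {}"
    using assms(2) by (auto simp: standard_space_def completely_metrizable_imp_metrizable_space)
  have haus: "Hausdorff_space X"
    using metr by (rule metrizable_imp_Hausdorff_space)
  have noncpt: "\<not> G \<subseteq> K" if "openin X G" "compactin X K" "x \<in> G" for G K x
    using assms(5) that openin_subset[of X G] unfolding nowhere_locally_compact_def by blast
  have "\<exists>x\<in>topspace X. \<exists>y\<in>topspace X. x \<noteq> y"
  proof -
    obtain x where x: "x \<in> topspace X" using ne by blast
    \<comment> \<open>A space with a single point would be a compact neighbourhood of that
      point.\<close>
    then have "compactin X {x}" by simp
    from noncpt[OF _ this x] x show ?thesis by auto
  qed
  moreover have "trivial_group (relative_homology_group (int k) X (topspace X - {x}))"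
    if x: "x \<in> topspace X" and k: "k < n" for x k
  proof -
    let ?T = "topspace X - {x}"
    have openT: "openin X ?T"
      using compactin_imp_closedin[OF haus, of "{x}"] x by (auto intro: openin_diff)
    have "k \<le> n - 1" using k by simp
    \<comment> \<open>Cycles in \<open>V\<close> only have to bound somewhere in \<open>X\<close>,
      so the outer neighbourhood is the whole space.\<close>
    then obtain V where V: "openin X V" "x \<in> V" and
      bound: "\<And>c. \<lbrakk>singular_relcycle k (subtopology X V) {} c; k = 0 \<Longrightarrow> chain_map 0 (\<lambda>_. x) c = 0\<rbrakk>
                \<Longrightarrow> singular_relboundary k (subtopology X (topspace X)) {} c"
      by (rule LC_space_small_cycles_bound[OF assms(4) x _ openin_topspace x]) blast
    have Vsub: "V \<subseteq> topspace X" using V openin_subset by blast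
    have "singular_relboundary k X ?T c" if c: "singular_relcycle k X ?T c" for c
    proof -
      \<comment> \<open>The complement of \<open>V\<close> is closed and misses \<open>x\<close>, so
        it can be excised.\<close>
      have cl: "X closure_of (topspace X - V) \<subseteq> X interior_of ?T"
        using V openT openin_closedin_eq[of X V]
        by (auto simp: closure_of_closedin interior_of_openin)
      have "singular_relcycle k (subtopology X (topspace X)) ?T c" using c by simp
      then obtain d where
        "singular_relcycle k (subtopology X (topspace X - (topspace X - V))) (?T - (topspace X - V)) d"
        "homologous_rel k (subtopology X (topspace X)) ?T c d"
        by (rule excised_relcycle_exists[OF cl Diff_subset])
      moreover have "topspace X - (topspace X - V) = V" "?T - (topspace X - V) = V - {x}"
        using Vsub by auto
      ultimately have d: "singular_relcycle k (subtopology X V) (V - {x}) d"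
        and cd: "homologous_rel k X ?T c d"
        by simp_all
      \<comment> \<open>For \<open>k = 0\<close> the boundary is zero, so the truncated degree
        \<open>k - 1\<close> does no harm.\<close>
      have dV: "singular_chain k (subtopology X V) d"
        and bdV: "singular_chain (k - 1) (subtopology X (V - {x})) (chain_boundary k d)"
        using d by (auto simp: singular_relcycle subtopology_subtopology Int_absorb1)
      obtain K where "compactin (subtopology X V) K"
        and "singular_chain k (subtopology (subtopology X V) K) d"
        using singular_chain_compact_support[OF dV] by blast
      then have K: "compactin X K" "K \<subseteq> V" and dK: "singular_chain k (subtopology X K) d"
        by (auto simp: compactin_subtopology subtopology_subtopology Int_absorb1)
      obtain L where "compactin (subtopology X (V - {x})) L"
        and "singular_chain (k - 1) (subtopology (subtopology X (V - {x})) L) (chain_boundary k d)"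
        using singular_chain_compact_support[OF bdV] by blast
      then have L: "compactin X L" "L \<subseteq> V - {x}"
        and dL: "singular_chain (k - 1) (subtopology X L) (chain_boundary k d)"
        by (auto simp: compactin_subtopology subtopology_subtopology Int_absorb1)
      have W: "openin X (V - L) \<and> x \<in> V - L"
        using V L haus by (auto intro: openin_diff compactin_imp_closedin)
      \<comment> \<open>Removing \<open>L\<close> keeps the support \<open>N\<close> of the
        homeomorphism off the boundary of \<open>d\<close>; \<open>G\<close> is an open set inside
        \<open>N\<close>, too large for the compact set \<open>K\<close> to cover.\<close>
      obtain G N where G: "openin X G" "x \<in> G" "G \<subseteq> N" "N \<subseteq> V - L" and
        N: "\<forall>y\<in>N. \<forall>z\<in>N. \<exists>h. homeomorphic_map X X h \<and> h y = z \<and> (\<forall>w\<in>topspace X - N. h w = w)"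
        using assms(3)[unfolded strongly_locally_homogeneous_def neighbourhood_base_at_def,
            rule_format, OF x W] by blast
      obtain y where y: "y \<in> G" "y \<notin> K"
        using noncpt[OF G(1) K(1) G(2)] by blast
      obtain h where h: "homeomorphic_map X X h" "h y = x"
        and hid: "\<And>w. w \<in> topspace X - N \<Longrightarrow> h w = w"
      proof -
        have "y \<in> N" "x \<in> N" using G y by auto
        with N that show thesis by blast
      qed
      have cont: "continuous_map X X h" and inj: "inj_on h (topspace X)"
        using h by (auto simp: homeomorphic_eq_everything_map)
      have hX: "h w \<in> topspace X" if "w \<in> topspace X" for w
        using cont that by (auto simp: continuous_map_def)
      have yX: "y \<in> topspace X" using y G openin_subset by blast
      \<comment> \<open>A value outside \<open>N\<close> is fixed by \<open>h\<close>, so by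
        injectivity the point itself was not moved.\<close>
      have "h w \<in> V" if "w \<in> V" for w
      proof (cases "h w \<in> N")
        case True
        then show ?thesis using G by auto
      next
        case False
        then have "h (h w) = h w" using hid hX that Vsub by auto
        then have "h w = w" using inj hX that Vsub by (meson inj_onD subsetD)
        with that show ?thesis by simp
      qed
      then have hV: "continuous_map (subtopology X V) (subtopology X V) h"
        using cont by (auto simp: continuous_map_in_subtopology continuous_map_from_subtopology)
      \<comment> \<open>Only \<open>y\<close> is sent to \<open>x\<close>, and \<open>y\<close> lies
        outside \<open>K\<close>.\<close>
      have "h w \<noteq> x" if "w \<in> K" for w
        using that inj h(2) y yX K Vsub by (metis inj_onD subsetD)
      then have hK: "continuous_map (subtopology X K) (subtopology X ?T) h"
        using cont hX by (auto simp: continuous_map_in_subtopology continuous_map_from_subtopology)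
      let ?e = "chain_map k h d"
      have "chain_boundary k ?e = chain_map (k - 1) h (chain_boundary k d)"
        using chain_boundary_chain_map[OF dV] by simp
      also have "\<dots> = chain_boundary k d"
      proof (rule chain_map_id_gen[OF dL])
        fix w assume "w \<in> topspace (subtopology X L)"
        with G have "w \<in> topspace X - N" by auto
        then show "h w = w" by (rule hid)
      qed
      finally have bd: "chain_boundary k (d - ?e) = 0"
        by (simp add: chain_boundary_diff)
      have "singular_relboundary k (subtopology X (topspace X)) {} (d - ?e)"
      proof (rule bound)
        show "singular_relcycle k (subtopology X V) {} (d - ?e)"
          using bd dV singular_chain_chain_map[OF dV hV] by (simp add: singular_cycle singular_chain_diff)
        \<comment> \<open>A constant map absorbs \<open>h\<close>, so \<open>d\<close> and its image
          have the same coefficient sum.\<close>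
        have "chain_map 0 (\<lambda>_. x) (chain_map 0 h d) = chain_map 0 (\<lambda>_. x) d"
          using chain_map_compose[of 0 "\<lambda>_. x" h] by (simp add: fun_eq_iff o_def)
        then show "k = 0 \<Longrightarrow> chain_map 0 (\<lambda>_. x) (d - ?e) = 0"
          by (simp add: chain_map_diff)
      qed
      then have "singular_relboundary k X ?T (d - ?e)"
        unfolding singular_boundary by (auto simp: singular_relboundary_def)
      moreover have "singular_relboundary k X ?T ?e"
        \<comment> \<open>The pushed chain lies in the complement of \<open>x\<close>, so it is zero
          relative to it.\<close>
        using singular_chain_chain_map[OF dK hK] by (rule singular_chain_imp_relboundary)
      ultimately have "singular_relboundary k X ?T d"
        using singular_relboundary_add by fastforce
      moreover have "singular_relboundary k X ?T (c - d)"
        using cd by (simp add: homologous_rel_def)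
      ultimately show ?thesis
        using singular_relboundary_add by fastforce
    qed
    then have "homologous_rel_set k X ?T c = singular_relboundary_set k X ?T"
      if "singular_relcycle k X ?T c" for c
      using that homologous_rel_set_eq_relboundary by blast
    moreover have "singular_relcycle k X ?T 0" by simp
    ultimately show ?thesis
      unfolding trivial_group_def carrier_relative_homology_group one_relative_homology_group
      by (auto simp only: group_relative_homology_group mem_Collect_eq)
  qed
  ultimately show ?thesis
    using metr sep by (simp add: almost_homology_manifold_def)
qed

end
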